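(* Let $\mathcal{K}\subset S^3$ be a knot with knot group $G$, commutator subgroup $K=[G,G]$ and distinguished meridian $x\in G$. Let $\Sigma$ be a finite abelian group, written as a direct sum of cyclic groups $\Sigma=\bigoplus_{i\in I}\mathbb{Z}/p_i^{r_i}$, where $I\subset\mathbb{N}$ is finite, the $p_i$ are primes and $r_i\ge1$. (i) Let $d_i$ be the least common multiple of the periods of orbits of $(\operatorname{Hom}(K,\mathbb{Z}/p_i^{r_i}),\sigma_x)$. Then the least common multiple of the periods of orbits of $(\operatorname{Hom}(K,\Sigma),\sigma_x)$ is $\operatorname{lcm}\{d_i: i\in I\}$. (ii) Let $Q_i$ be the set of periods of orbits of $(\operatorname{Hom}(K,\mathbb{Z}/p_i^{r_i}),\sigma_x)$. Then the set of periods of orbits of $(\operatorname{Hom}(K,\Sigma),\sigma_x)$ is $$Q=\{\operatorname{lcm}\{q_i: i\in I\}:\ q_i\in Q_i \text{ for each } i\in I\}.$$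
   Context: The knot group is $G=\pi_1(S^3\setminus\mathcal{K})$. For a finite abelian group $\Sigma$, the shift map $\sigma_x:\operatorname{Hom}(K,\Sigma)\to\operatorname{Hom}(K,\Sigma)$ is $(\sigma_x\rho)(a)=\rho(xax^{-1})$ for $a\in K$. It is a bijection of a finite set, so it decomposes into finitely many cycles (orbits); the period of an orbit is its length. *)

theory Defs
  imports
    "HOL-Analysis.Analysis"
    "HOL-Combinatorics.Orbits"
    "HOL-Algebra.Product_Groups"
begin

section \<open>The fundamental group\<close>

definition loops_at :: "'a::topological_space set \<Rightarrow> 'a \<Rightarrow> (real \<Rightarrow> 'a) set" where
  "loops_at S b = {p. path p \<and> path_image p \<subseteq> S \<and> pathstart p = b \<and> pathfinish p = b}"

definition loop_class :: "'a::topological_space set \<Rightarrow> (real \<Rightarrow> 'a) \<Rightarrow> (real \<Rightarrow> 'a) set" where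
  "loop_class S p = {q. homotopic_paths S p q}"

text \<open>The product of two classes is the class of the concatenation, first factor travelled
  first; it is written as a union over representatives, all of which give the same class.\<close>

definition fundamental_group ::
    "'a::topological_space set \<Rightarrow> 'a \<Rightarrow> (real \<Rightarrow> 'a) set monoid" where
  "fundamental_group S b =
     \<lparr>carrier = loop_class S ` loops_at S b,
      monoid.mult = (\<lambda>A B. \<Union>p\<in>A. \<Union>q\<in>B. loop_class S (p +++ q)),
      one = loop_class S (\<lambda>t. b)\<rparr>"

lemma loop_class_eq:
  assumes "homotopic_paths S p q"
  shows "loop_class S p = loop_class S q"
proof -
  have "homotopic_paths S p r \<longleftrightarrow> homotopic_paths S q r" for r
    using assms homotopic_paths_sym[OF assms] homotopic_paths_trans[of S p q r]
      homotopic_paths_trans[of S q p r] by blast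
  then show ?thesis
    by (simp add: loop_class_def)
qed

lemma fundamental_group_mult:
  fixes b :: "'a::real_normed_vector"
  assumes "p \<in> loops_at S b" "q \<in> loops_at S b"
  shows "loop_class S p \<otimes>\<^bsub>fundamental_group S b\<^esub> loop_class S q = loop_class S (p +++ q)"
proof -
  have cls: "loop_class S (p' +++ q') = loop_class S (p +++ q)"
    if "p' \<in> loop_class S p" "q' \<in> loop_class S q" for p' q'
  proof (rule loop_class_eq)
    have "homotopic_paths S (p +++ q) (p' +++ q')"
      using that assms by (intro homotopic_paths_join) (simp_all add: loop_class_def loops_at_def)
    then show "homotopic_paths S (p' +++ q') (p +++ q)"
      by (rule homotopic_paths_sym)
  qed
  have "p \<in> loop_class S p" "q \<in> loop_class S q"
    using assms by (auto simp: loop_class_def loops_at_def)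
  then have "(\<Union>p'\<in>loop_class S p. \<Union>q'\<in>loop_class S q. loop_class S (p' +++ q')) =
      loop_class S (p +++ q)"
    using cls by blast
  then show ?thesis
    by (simp add: fundamental_group_def)
qed

lemma group_fundamental_group:
  fixes b :: "'a::real_normed_vector"
  assumes b: "b \<in> S"
  shows "group (fundamental_group S b)"
proof (rule groupI)
  let ?P = "fundamental_group S b"
  have carr: "carrier ?P = loop_class S ` loops_at S b"
    and one: "\<one>\<^bsub>?P\<^esub> = loop_class S (linepath b b)"
    by (simp_all add: fundamental_group_def linepath_refl)
  have const: "linepath b b \<in> loops_at S b"
    using b by (auto simp: loops_at_def)
  have join: "p +++ q \<in> loops_at S b" if "p \<in> loops_at S b" "q \<in> loops_at S b" for p q
    using that by (auto simp: loops_at_def path_image_join)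
  show "X \<otimes>\<^bsub>?P\<^esub> Y \<in> carrier ?P" if "X \<in> carrier ?P" "Y \<in> carrier ?P" for X Y
    using that join by (auto simp: carr fundamental_group_mult)
  show "\<one>\<^bsub>?P\<^esub> \<in> carrier ?P"
    using const by (auto simp: carr one)
  show "X \<otimes>\<^bsub>?P\<^esub> Y \<otimes>\<^bsub>?P\<^esub> Z = X \<otimes>\<^bsub>?P\<^esub> (Y \<otimes>\<^bsub>?P\<^esub> Z)"
    if XYZ: "X \<in> carrier ?P" "Y \<in> carrier ?P" "Z \<in> carrier ?P" for X Y Z
  proof -
    obtain p q r where pqr: "p \<in> loops_at S b" "q \<in> loops_at S b" "r \<in> loops_at S b"
      and eqs: "X = loop_class S p" "Y = loop_class S q" "Z = loop_class S r"
      using XYZ by (auto simp: carr)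
    have hom: "homotopic_paths S (p +++ (q +++ r)) ((p +++ q) +++ r)"
      using pqr by (intro homotopic_paths_assoc) (simp_all add: loops_at_def)
    show ?thesis
      using pqr join by (simp add: eqs fundamental_group_mult loop_class_eq[OF hom])
  qed
  show "\<one>\<^bsub>?P\<^esub> \<otimes>\<^bsub>?P\<^esub> X = X" if X: "X \<in> carrier ?P" for X
  proof -
    obtain p where p: "p \<in> loops_at S b" "X = loop_class S p"
      using X by (auto simp: carr)
    have hom: "homotopic_paths S (linepath b b +++ p) p"
      using p homotopic_paths_lid[of p S] by (auto simp: loops_at_def)
    show ?thesis
      using p const by (simp add: one fundamental_group_mult loop_class_eq[OF hom])
  qed
  show "\<exists>Y\<in>carrier ?P. Y \<otimes>\<^bsub>?P\<^esub> X = \<one>\<^bsub>?P\<^esub>" if X: "X \<in> carrier ?P" for X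
  proof -
    obtain p where p: "p \<in> loops_at S b" "X = loop_class S p"
      using X by (auto simp: carr)
    have rp: "reversepath p \<in> loops_at S b"
      using p by (auto simp: loops_at_def)
    have hom: "homotopic_paths S (reversepath p +++ p) (linepath b b)"
      using p homotopic_paths_linv[of p S] by (auto simp: loops_at_def)
    have "loop_class S (reversepath p) \<otimes>\<^bsub>?P\<^esub> X = \<one>\<^bsub>?P\<^esub>"
      using p rp by (simp add: one fundamental_group_mult loop_class_eq[OF hom])
    then show ?thesis
      using rp by (auto simp: carr)
  qed
qed

section \<open>Knots, knot groups and meridians\<close>

abbreviation S3 :: "(real^4) set" where
  "S3 \<equiv> sphere 0 1"

text \<open>A closed tubular neighbourhood, given by a parametrization of a solid torus with core
  the given set. The domain is compact, so the continuous injection is a topological embedding.\<close>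

definition tubular_nbhd :: "(real^4) set \<Rightarrow> (complex \<times> complex \<Rightarrow> real^4) \<Rightarrow> bool" where
  "tubular_nbhd \<K> h \<longleftrightarrow>
     continuous_on (sphere 0 1 \<times> cball 0 1) h \<and>
     inj_on h (sphere 0 1 \<times> cball 0 1) \<and>
     h ` (sphere 0 1 \<times> cball 0 1) \<subseteq> S3 \<and>
     h ` (sphere 0 1 \<times> {0}) = \<K>"

text \<open>Knots are tame: circles embedded in the 3-sphere that can be thickened to a solid torus.
  This includes all smooth, all polygonal and all locally flat knots.\<close>

definition knot :: "(real^4) set \<Rightarrow> bool" where
  "knot \<K> \<longleftrightarrow> \<K> \<subseteq> S3 \<and> \<K> homeomorphic sphere (0::complex) 1 \<and> (\<exists>h. tubular_nbhd \<K> h)"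

definition knot_group :: "(real^4) set \<Rightarrow> real^4 \<Rightarrow> (real \<Rightarrow> real^4) set monoid" where
  "knot_group \<K> b = fundamental_group (S3 - \<K>) b"

text \<open>A meridian is the boundary circle of a meridional disc of a tubular neighbourhood, joined
  to the base point by an arc in the complement. Precomposing the parametrization with
  complex conjugation on the disc factor reverses the circle, so both orientations are included,
  in particular the one prescribed by any orientation of the knot.\<close>

definition meridian :: "(real^4) set \<Rightarrow> real^4 \<Rightarrow> (real \<Rightarrow> real^4) set \<Rightarrow> bool" where
  "meridian \<K> b x \<longleftrightarrow>
     (\<exists>h \<gamma>. tubular_nbhd \<K> h \<and>
        path \<gamma> \<and> path_image \<gamma> \<subseteq> S3 - \<K> \<and> pathstart \<gamma> = b \<and> pathfinish \<gamma> = h (1, 1) \<and>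
        x = loop_class (S3 - \<K>)
              (\<gamma> +++ ((\<lambda>t. h (1, cis (2 * pi * t))) +++ reversepath \<gamma>)))"

lemma meridian_in_knot_group:
  assumes "meridian \<K> b x"
  shows "x \<in> carrier (knot_group \<K> b)"
proof -
  obtain h \<gamma> where h: "tubular_nbhd \<K> h"
    and \<gamma>: "path \<gamma>" "path_image \<gamma> \<subseteq> S3 - \<K>" "pathstart \<gamma> = b" "pathfinish \<gamma> = h (1, 1)"
    and x: "x = loop_class (S3 - \<K>)
              (\<gamma> +++ ((\<lambda>t. h (1, cis (2 * pi * t))) +++ reversepath \<gamma>))"
    using assms by (auto simp: meridian_def)
  define c where "c = (\<lambda>t. h (1, cis (2 * pi * t)))"
  have ends: "pathstart c = h (1, 1)" "pathfinish c = h (1, 1)"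
    by (simp_all add: c_def pathstart_def pathfinish_def)
  have cont: "continuous_on (sphere 0 1 \<times> cball 0 1) h"
    and inj: "inj_on h (sphere 0 1 \<times> cball 0 1)"
    and sub: "h ` (sphere 0 1 \<times> cball 0 1) \<subseteq> S3"
    and core: "h ` (sphere 0 1 \<times> {0}) = \<K>"
    using h by (auto simp: tubular_nbhd_def)
  have "path c"
    unfolding path_def c_def
    by (rule continuous_on_compose2[OF cont])
       (auto intro!: continuous_intros)
  moreover have "c t \<in> S3 - \<K>" for t
  proof -
    have dom: "(1::complex, cis (2 * pi * t)) \<in> sphere 0 1 \<times> cball 0 1"
      by simp
    have "c t \<in> S3"
      using sub dom unfolding c_def by blast
    moreover have "c t \<notin> \<K>"
    proof
      assume "c t \<in> \<K>"
      then obtain z where z: "z \<in> sphere 0 1" "h (1, cis (2 * pi * t)) = h (z, 0)"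
        unfolding c_def core[symmetric] by auto
      have "(z, 0::complex) \<in> sphere 0 1 \<times> cball 0 1"
        using z by auto
      then have "(1, cis (2 * pi * t)) = (z, 0)"
        using inj_onD[OF inj z(2) dom] by simp
      then show False
        by simp
    qed
    ultimately show ?thesis
      by blast
  qed
  ultimately have "\<gamma> +++ (c +++ reversepath \<gamma>) \<in> loops_at (S3 - \<K>) b"
    using \<gamma> ends by (auto simp: loops_at_def path_image_join path_image_def[of c])
  then show ?thesis
    by (auto simp: x c_def knot_group_def fundamental_group_def)
qed

section \<open>The shift on representations of the commutator subgroup\<close>

definition commutator_subgroup :: "('g, 'c) monoid_scheme \<Rightarrow> ('g, 'c) monoid_scheme" where
  "commutator_subgroup G = G\<lparr>carrier := derived G (carrier G)\<rparr>"

text \<open>Two elements of \<^const>\<open>hom\<close> may differ outside the carrier of the domain, so the values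
  there are fixed to be \<^const>\<open>undefined\<close>; otherwise homomorphisms would be counted repeatedly.\<close>

definition Hom :: "('g, 'c) monoid_scheme \<Rightarrow> ('s, 't) monoid_scheme \<Rightarrow> ('g \<Rightarrow> 's) set" where
  "Hom K A = hom K A \<inter> extensional (carrier K)"

definition shift :: "('g, 'c) monoid_scheme \<Rightarrow> 'g \<Rightarrow> ('g \<Rightarrow> 's) \<Rightarrow> ('g \<Rightarrow> 's)" where
  "shift G x \<rho> =
     (\<lambda>a\<in>carrier (commutator_subgroup G). \<rho> (x \<otimes>\<^bsub>G\<^esub> a \<otimes>\<^bsub>G\<^esub> inv\<^bsub>G\<^esub> x))"

text \<open>The library's \<^const>\<open>orbit\<close> collects the iterates under positive powers only, which for a
  permutation of a finite set is the whole cycle. Its cardinality is the period.\<close>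

definition shift_orbits ::
    "('g, 'c) monoid_scheme \<Rightarrow> 'g \<Rightarrow> ('s, 't) monoid_scheme \<Rightarrow> ('g \<Rightarrow> 's) set set" where
  "shift_orbits G x A = orbit (shift G x) ` Hom (commutator_subgroup G) A"

definition orbit_periods ::
    "('g, 'c) monoid_scheme \<Rightarrow> 'g \<Rightarrow> ('s, 't) monoid_scheme \<Rightarrow> nat set" where
  "orbit_periods G x A = card ` shift_orbits G x A"

end

theory Submission
  imports Defs
begin

text \<open>
  This is a statement about an element \<open>x\<close> of a group \<open>G\<close> acting by conjugation on the
  commutator subgroup \<open>K\<close>. A homomorphism from \<open>K\<close> to
  \<open>\<Sigma> = \<Oplus>\<^sub>i B\<^sub>i\<close> is a family of homomorphisms \<open>\<rho>\<^sub>i : K \<rightarrow> B\<^sub>i\<close>, and the shift acts on each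
  component separately because it only changes the argument. Hence a power of the shift fixes
  \<open>\<rho>\<close> if and only if it fixes every \<open>\<rho>\<^sub>i\<close>.

  The period of an orbit is characterised by divisibility: it divides \<open>n\<close> exactly when the
  \<open>n\<close>-th power of the shift fixes the given point (\<open>card_orbit_dvd_iff\<close>). So the period of
  \<open>\<rho>\<close> divides \<open>n\<close> if and only if all the periods of the \<open>\<rho>\<^sub>i\<close> do, which says that it is their
  least common multiple (\<open>card_orbit_family\<close>). As the \<open>\<rho>\<^sub>i\<close> can be chosen independently, this
  is the description of the set of periods, and the least common multiple of that set is then
  computed in the divisibility lattice (\<open>Lcm_of_LCM_choices\<close>).

  An infinite orbit has cardinality \<open>0\<close>, the top element of the divisibility lattice of the
  natural numbers, and \<open>0\<close> divides only \<open>0\<close>. With this convention the characterisation by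
  divisibility covers infinite orbits as well as finite ones.
\<close>

section \<open>Periods and divisibility\<close>

text \<open>Injectivity is what makes the orbit of a point that never returns infinite: from
  \<open>f\<^sup>m z = f\<^sup>n z\<close> one can cancel the smaller power.\<close>

lemma card_orbit_dvd_iff:
  assumes inj: "inj_on f S" and closed: "f ` S \<subseteq> S" and z: "z \<in> S"
  shows "card (orbit f z) dvd n \<longleftrightarrow> (f ^^ n) z = z"
proof (cases "z \<in> orbit f z")
  case True
  define m where "m = funpow_dist1 f z z"
  have m: "(f ^^ m) z = z"
    unfolding m_def by (rule funpow_dist1_prop[OF True])
  have "card (orbit f z) = m"
    unfolding orbit_conv_funpow_dist1[OF True] card_image[OF inj_on_funpow_dist1[OF True]]
    by (simp add: m_def)
  moreover have "m dvd n \<longleftrightarrow> (f ^^ n) z = z"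
  proof
    assume "m dvd n"
    then show "(f ^^ n) z = z"
      using funpow_mod_eq[OF m, of n] by (simp add: dvd_eq_mod_eq_0)
  next
    assume "(f ^^ n) z = z"
    then have "(f ^^ (n mod m)) z = z"
      using funpow_mod_eq[OF m, of n] by simp
    moreover have "n mod m < m"
      by (simp add: m_def)
    ultimately have "n mod m = 0"
      using funpow_dist1_least[of "n mod m" f z z] unfolding m_def by blast
    then show "m dvd n"
      by (simp add: dvd_eq_mod_eq_0)
  qed
  ultimately show ?thesis
    by simp
next
  case False
  have stay: "(f ^^ k) z \<in> S" for k
    using closed z by (induction k) auto
  have return: "(f ^^ k) z = z" if "(f ^^ (j + k)) z = (f ^^ j) z" for j k
    using that
  proof (induction j)
    case (Suc j)
    then have "f ((f ^^ (j + k)) z) = f ((f ^^ j) z)"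
      by simp
    then have "(f ^^ (j + k)) z = (f ^^ j) z"
      by (rule inj_onD[OF inj _ stay stay])
    then show ?case
      by (rule Suc.IH)
  qed simp
  have no_return: "k = 0" if "(f ^^ k) z = z" for k
  proof (rule ccontr)
    assume "k \<noteq> 0"
    then have "(f ^^ k) z \<in> orbit f z"
      unfolding orbit_altdef by blast
    then show False
      using that False by simp
  qed
  have "inj (\<lambda>k. (f ^^ Suc k) z)"
  proof (rule linorder_injI)
    fix j k :: nat
    assume "j < k"
    define l where "l = k - j"
    have l: "Suc k = Suc j + l" "l \<noteq> 0"
      using \<open>j < k\<close> by (simp_all add: l_def)
    show "(f ^^ Suc j) z \<noteq> (f ^^ Suc k) z"
    proof
      assume "(f ^^ Suc j) z = (f ^^ Suc k) z"
      then have "(f ^^ l) z = z"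
        unfolding l by (intro return[of "Suc j"]) (rule sym)
      then show False
        using no_return l by blast
    qed
  qed
  then have "infinite (range (\<lambda>k. (f ^^ Suc k) z))"
    by (rule range_inj_infinite)
  moreover have "range (\<lambda>k. (f ^^ Suc k) z) \<subseteq> orbit f z"
    unfolding orbit_altdef by (blast intro: zero_less_Suc)
  ultimately have "infinite (orbit f z)"
    by (meson infinite_super)
  then have "card (orbit f z) = 0"
    by (rule card.infinite)
  moreover have "(f ^^ n) z = z \<longleftrightarrow> n = 0"
    by (metis no_return funpow_0)
  ultimately show ?thesis
    by simp
qed

text \<open>Nonemptiness is needed for the choices: if some \<open>Q i\<close> is empty, there is no choice at all
  and the left-hand side is \<open>1\<close>.\<close>

lemma Lcm_of_LCM_choices:
  fixes Q :: "'i \<Rightarrow> nat set"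
  assumes nonempty: "\<And>i. i \<in> I \<Longrightarrow> Q i \<noteq> {}"
  shows "Lcm {(LCM i\<in>I. q i) | q. \<forall>i\<in>I. q i \<in> Q i} = (LCM i\<in>I. Lcm (Q i))"
    (is "Lcm ?C = ?L")
proof (rule dvd_antisym)
  show "Lcm ?C dvd ?L"
  proof (rule Lcm_least)
    fix c
    assume "c \<in> ?C"
    then obtain q where q: "\<forall>i\<in>I. q i \<in> Q i" and c: "c = (LCM i\<in>I. q i)"
      by blast
    have "q i dvd ?L" if "i \<in> I" for i
      using q that by (meson dvd_Lcm dvd_trans image_eqI)
    then show "c dvd ?L"
      unfolding c by (auto intro: Lcm_least)
  qed
  have "a dvd Lcm ?C" if i: "i \<in> I" and a: "a \<in> Q i" for i a
  proof -
    \<comment> \<open>Every element of \<open>Q i\<close> occurs in a choice, the other entries being arbitrary.\<close>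
    define q where "q j = (if j = i then a else (SOME b. b \<in> Q j))" for j
    have "q j \<in> Q j" if "j \<in> I" for j
      using a nonempty[OF that] by (auto simp: q_def some_in_eq)
    then have "(LCM j\<in>I. q j) dvd Lcm ?C"
      by (intro dvd_Lcm) blast
    moreover have "a dvd (LCM j\<in>I. q j)"
      using i by (intro dvd_Lcm image_eqI[of _ _ i]) (auto simp: q_def)
    ultimately show ?thesis
      by (rule dvd_trans[rotated])
  qed
  then show "?L dvd Lcm ?C"
    by (auto intro!: Lcm_least)
qed

section \<open>The shift as precomposition\<close>

definition conjugate :: "('g, 'c) monoid_scheme \<Rightarrow> 'g \<Rightarrow> 'g \<Rightarrow> 'g" where
  "conjugate G x a = x \<otimes>\<^bsub>G\<^esub> a \<otimes>\<^bsub>G\<^esub> inv\<^bsub>G\<^esub> x"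

lemma conjugate_image_commutator_subgroup:
  assumes G: "group G" and x: "x \<in> carrier G"
  shows "conjugate G x ` carrier (commutator_subgroup G) = carrier (commutator_subgroup G)"
proof -
  interpret group G by fact
  let ?D = "derived G (carrier G)"
  interpret D: normal ?D G
    using derived_is_normal[OF normal_self] .
  have "conjugate G x ` ?D = ?D"
  proof
    show "conjugate G x ` ?D \<subseteq> ?D"
      using D.inv_op_closed2[OF x] by (auto simp: conjugate_def)
    show "?D \<subseteq> conjugate G x ` ?D"
    proof
      fix a
      assume a: "a \<in> ?D"
      have "a \<in> carrier G"
        using a D.subset by blast
      then have "conjugate G x (inv\<^bsub>G\<^esub> x \<otimes>\<^bsub>G\<^esub> a \<otimes>\<^bsub>G\<^esub> x) = a"
        using x by (simp add: conjugate_def m_assoc) (simp add: m_assoc[symmetric])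
      then show "a \<in> conjugate G x ` ?D"
        using D.inv_op_closed1[OF x a] by (metis imageI)
    qed
  qed
  then show ?thesis
    by (simp add: commutator_subgroup_def)
qed

text \<open>Surjectivity of conjugation on \<open>K\<close> makes the shift injective on all functions on \<open>K\<close>,
  so that the divisibility characterisation applies. The right-hand side compares values of \<open>\<rho>\<close>
  at points that do not depend on \<open>\<rho>\<close>, which is the form in which components separate.\<close>

lemma card_orbit_shift_dvd_iff:
  assumes G: "group G" and x: "x \<in> carrier G"
    and \<rho>: "\<rho> \<in> extensional (carrier (commutator_subgroup G))"
  shows "card (orbit (shift G x) \<rho>) dvd n \<longleftrightarrow>
    (\<forall>a\<in>carrier (commutator_subgroup G). \<rho> ((conjugate G x ^^ n) a) = \<rho> a)"
proof -
  define K where "K = carrier (commutator_subgroup G)"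
  have onto: "conjugate G x ` K = K"
    unfolding K_def by (rule conjugate_image_commutator_subgroup[OF G x])
  have shift: "shift G x \<tau> = (\<lambda>a\<in>K. \<tau> (conjugate G x a))" for \<tau> :: "'a \<Rightarrow> 'c"
    by (simp add: shift_def K_def conjugate_def)
  have "inj_on (shift G x) (extensional K :: ('a \<Rightarrow> 'c) set)"
  proof (rule inj_onI)
    fix \<tau> \<tau>' :: "'a \<Rightarrow> 'c"
    assume ext: "\<tau> \<in> extensional K" "\<tau>' \<in> extensional K"
      and eq: "shift G x \<tau> = shift G x \<tau>'"
    show "\<tau> = \<tau>'"
    proof (rule extensionalityI[OF ext])
      fix a
      assume "a \<in> K"
      then obtain c where "c \<in> K" "a = conjugate G x c"
        using onto by blast
      then show "\<tau> a = \<tau>' a"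
        using fun_cong[OF eq, of c] by (simp add: shift)
    qed
  qed
  moreover have "shift G x ` (extensional K :: ('a \<Rightarrow> 'c) set) \<subseteq> extensional K"
    by (auto simp: shift)
  moreover have "(shift G x ^^ n) \<rho> = (\<lambda>a\<in>K. \<rho> ((conjugate G x ^^ n) a))"
  proof (induction n)
    case 0
    then show ?case
      using \<rho> by (simp add: K_def extensional_restrict)
  next
    case (Suc n)
    have "conjugate G x a \<in> K" if "a \<in> K" for a
      using that onto by blast
    then show ?case
      unfolding funpow.simps o_apply Suc.IH unfolding shift
      by (intro restrict_ext) (simp add: funpow_swap1)
  qed
  moreover have "(\<lambda>a\<in>K. \<rho> ((conjugate G x ^^ n) a)) = \<rho> \<longleftrightarrow>
      (\<forall>a\<in>K. \<rho> ((conjugate G x ^^ n) a) = \<rho> a)"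
  proof
    assume "(\<lambda>a\<in>K. \<rho> ((conjugate G x ^^ n) a)) = \<rho>"
    then show "\<forall>a\<in>K. \<rho> ((conjugate G x ^^ n) a) = \<rho> a"
      by (metis restrict_apply')
  next
    assume "\<forall>a\<in>K. \<rho> ((conjugate G x ^^ n) a) = \<rho> a"
    then show "(\<lambda>a\<in>K. \<rho> ((conjugate G x ^^ n) a)) = \<rho>"
      using \<rho> by (intro extensionalityI[of _ K]) (auto simp: K_def)
  qed
  ultimately show ?thesis
    using card_orbit_dvd_iff[of "shift G x" "extensional K" \<rho> n] \<rho> by (simp add: K_def)
qed

text \<open>A natural number is determined by its multiples, so it suffices that \<open>n\<close> is a multiple of the
  left-hand side exactly when it is a multiple of every period on the right. The hypothesis
  \<open>separates\<close> abstracts from the direct sum: the period of a function depends only on which of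
  its values coincide, and coincidences can be tested on components.\<close>

lemma card_orbit_family:
  assumes G: "group G" and x: "x \<in> carrier G"
    and \<rho>: "\<rho> \<in> extensional (carrier (commutator_subgroup G))"
    and \<rho>': "\<And>i. i \<in> I \<Longrightarrow> \<rho>' i \<in> extensional (carrier (commutator_subgroup G))"
    and separates: "\<And>a c. a \<in> carrier (commutator_subgroup G) \<Longrightarrow>
      c \<in> carrier (commutator_subgroup G) \<Longrightarrow> \<rho> a = \<rho> c \<longleftrightarrow> (\<forall>i\<in>I. \<rho>' i a = \<rho>' i c)"
  shows "card (orbit (shift G x) \<rho>) = (LCM i\<in>I. card (orbit (shift G x) (\<rho>' i)))"
proof -
  let ?K = "carrier (commutator_subgroup G)"
  have stay: "(conjugate G x ^^ n) a \<in> ?K" if "a \<in> ?K" for n a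
    using that conjugate_image_commutator_subgroup[OF G x] by (induction n) auto
  have "card (orbit (shift G x) \<rho>) dvd n \<longleftrightarrow> (LCM i\<in>I. card (orbit (shift G x) (\<rho>' i))) dvd n"
    for n
  proof -
    have "card (orbit (shift G x) \<rho>) dvd n \<longleftrightarrow>
        (\<forall>a\<in>?K. \<forall>i\<in>I. \<rho>' i ((conjugate G x ^^ n) a) = \<rho>' i a)"
      unfolding card_orbit_shift_dvd_iff[OF G x \<rho>] using separates stay by blast
    also have "\<dots> \<longleftrightarrow> (\<forall>i\<in>I. card (orbit (shift G x) (\<rho>' i)) dvd n)"
      using card_orbit_shift_dvd_iff[OF G x \<rho>'] by blast
    also have "\<dots> \<longleftrightarrow> (LCM i\<in>I. card (orbit (shift G x) (\<rho>' i))) dvd n"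
      by (simp add: Lcm_dvd_iff)
    finally show ?thesis .
  qed
  then show ?thesis
    by (meson dvd_antisym dvd_refl)
qed

section \<open>Representations into a direct sum\<close>

text \<open>Membership in a direct sum also demands finite support; finiteness of \<open>I\<close> makes that
  automatic, so that arbitrary families of components assemble to a homomorphism. The clause on
  \<^const>\<open>extensional\<close> is there because elements of the sum are functions fixed outside \<open>I\<close>.\<close>

lemma hom_into_sum_group_iff:
  assumes "group K" and "finite I" and "\<And>i. i \<in> I \<Longrightarrow> group (B i)"
  shows "f \<in> hom K (sum_group I B) \<longleftrightarrow>
    (\<forall>a\<in>carrier K. f a \<in> extensional I) \<and> (\<forall>i\<in>I. (\<lambda>a. f a i) \<in> hom K (B i))"
    (is "?L \<longleftrightarrow> ?E \<and> ?R")
proof -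
  have carr: "carrier (sum_group I B) = (\<Pi>\<^sub>E i\<in>I. carrier (B i))"
    using assms by (simp add: carrier_sum_group)
  show ?thesis
  proof
    assume ?L
    then show "?E \<and> ?R"
      by (auto simp: hom_def carr PiE_iff Pi_iff)
  next
    assume R: "?E \<and> ?R"
    show ?L
    proof (rule homI)
      show "f a \<in> carrier (sum_group I B)" if "a \<in> carrier K" for a
        using R that by (auto simp: hom_def carr PiE_iff Pi_iff)
      fix a c
      assume ac: "a \<in> carrier K" "c \<in> carrier K"
      then have "a \<otimes>\<^bsub>K\<^esub> c \<in> carrier K"
        using group.is_monoid[OF \<open>group K\<close>] by (simp add: monoid.m_closed)
      then show "f (a \<otimes>\<^bsub>K\<^esub> c) = f a \<otimes>\<^bsub>sum_group I B\<^esub> f c"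
        using R ac by (intro extensionalityI[of _ I]) (auto simp: hom_def)
    qed
  qed
qed

text \<open>Elements of \<^const>\<open>Hom\<close> are built below by restricting formulas to \<open>K\<close>; closure of \<open>K\<close>
  under multiplication is why the restriction is still multiplicative.\<close>

lemma Hom_restrict_iff:
  assumes "group K"
  shows "restrict f (carrier K) \<in> Hom K A \<longleftrightarrow> f \<in> hom K A"
proof -
  interpret group K by fact
  show ?thesis
    by (auto simp: Hom_def hom_def Pi_iff)
qed

lemma group_commutator_subgroup:
  assumes "group G"
  shows "group (commutator_subgroup G)"
proof -
  interpret group G by fact
  show ?thesis
    unfolding commutator_subgroup_def
    by (rule subgroup.subgroup_is_group[OF derived_is_subgroup]) (rule subset_refl is_group)+
qed

text \<open>The isomorphism with the direct sum is used in both directions, to split a homomorphism into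
  components and to assemble one from chosen components. Being injective, it preserves which values
  of \<open>\<rho>\<close> coincide, so \<open>card_orbit_family\<close> applies.\<close>

lemma orbit_periods_sum_group:
  assumes G: "group G" and x: "x \<in> carrier G"
    and A: "group A" and I: "finite I" and B: "\<And>i. i \<in> I \<Longrightarrow> group (B i)"
    and iso: "A \<cong> sum_group I B"
  shows "orbit_periods G x A = {(LCM i\<in>I. q i) | q. \<forall>i\<in>I. q i \<in> orbit_periods G x (B i)}"
    (is "_ = ?R")
proof -
  define K where "K = commutator_subgroup G"
  have K: "group K"
    unfolding K_def by (rule group_commutator_subgroup[OF G])
  have periods: "orbit_periods G x C = (\<lambda>\<rho>. card (orbit (shift G x) \<rho>)) ` Hom K C"
    for C :: "('u, 'v) monoid_scheme"
    by (simp add: orbit_periods_def shift_orbits_def K_def image_image)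
  obtain \<phi> where \<phi>: "\<phi> \<in> iso A (sum_group I B)"
    using iso by (auto simp: is_iso_def)
  define \<psi> where "\<psi> = inv_into (carrier A) \<phi>"
  have \<psi>: "\<psi> \<in> iso (sum_group I B) A"
    unfolding \<psi>_def by (rule group.iso_set_sym[OF A \<phi>])
  have into_sum: "f \<in> hom K (sum_group I B) \<longleftrightarrow>
      (\<forall>a\<in>carrier K. f a \<in> extensional I) \<and> (\<forall>i\<in>I. (\<lambda>a. f a i) \<in> hom K (B i))" for f
    using K I B by (rule hom_into_sum_group_iff)
  have \<phi>_inj: "inj_on \<phi> (carrier A)" and \<phi>_hom: "\<phi> \<in> hom A (sum_group I B)"
    using \<phi> by (auto simp: iso_def bij_betw_def)
  have \<psi>_inj: "inj_on \<psi> (carrier (sum_group I B))" and \<psi>_hom: "\<psi> \<in> hom (sum_group I B) A"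
    using \<psi> by (auto simp: iso_def bij_betw_def)
  show ?thesis
  proof
    show "orbit_periods G x A \<subseteq> ?R"
    proof
      fix d
      assume "d \<in> orbit_periods G x A"
      then obtain \<rho> where \<rho>: "\<rho> \<in> Hom K A" and d: "d = card (orbit (shift G x) \<rho>)"
        by (auto simp: periods)
      define \<rho>' where "\<rho>' i = (\<lambda>a\<in>carrier K. \<phi> (\<rho> a) i)" for i
      have hom: "(\<lambda>a. \<phi> (\<rho> a)) \<in> hom K (sum_group I B)"
        using \<rho> hom_compose[of \<rho> K A \<phi>] \<phi>_hom by (simp add: Hom_def o_def)
      then have \<rho>': "\<rho>' i \<in> Hom K (B i)" if "i \<in> I" for i
        using that unfolding into_sum \<rho>'_def Hom_restrict_iff[OF K] by blast
      have "d = (LCM i\<in>I. card (orbit (shift G x) (\<rho>' i)))"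
        unfolding d
      proof (rule card_orbit_family[OF G x], fold K_def)
        show "\<rho> \<in> extensional (carrier K)"
          using \<rho> by (simp add: Hom_def)
        show "\<rho>' i \<in> extensional (carrier K)" for i
          by (simp add: \<rho>'_def)
        fix a c
        assume ac: "a \<in> carrier K" "c \<in> carrier K"
        have ext: "\<phi> (\<rho> a) \<in> extensional I" "\<phi> (\<rho> c) \<in> extensional I"
          using hom ac unfolding into_sum by blast+
        have "\<rho> a \<in> carrier A" "\<rho> c \<in> carrier A"
          using \<rho> ac by (auto simp: Hom_def hom_def)
        then have "\<rho> a = \<rho> c \<longleftrightarrow> \<phi> (\<rho> a) = \<phi> (\<rho> c)"
          using \<phi>_inj by (auto dest: inj_onD)
        also have "\<dots> \<longleftrightarrow> (\<forall>i\<in>I. \<phi> (\<rho> a) i = \<phi> (\<rho> c) i)"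
          by (auto intro: extensionalityI[OF ext])
        finally show "\<rho> a = \<rho> c \<longleftrightarrow> (\<forall>i\<in>I. \<rho>' i a = \<rho>' i c)"
          using ac by (simp add: \<rho>'_def)
      qed
      moreover have "\<forall>i\<in>I. card (orbit (shift G x) (\<rho>' i)) \<in> orbit_periods G x (B i)"
        using \<rho>' by (auto simp: periods)
      ultimately show "d \<in> ?R"
        by blast
    qed
    show "?R \<subseteq> orbit_periods G x A"
    proof
      fix d
      assume "d \<in> ?R"
      then obtain q where q: "\<forall>i\<in>I. q i \<in> orbit_periods G x (B i)" and d: "d = (LCM i\<in>I. q i)"
        by blast
      then have "\<forall>i\<in>I. \<exists>\<tau>. \<tau> \<in> Hom K (B i) \<and> q i = card (orbit (shift G x) \<tau>)"
        by (auto simp: periods)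
      then obtain \<rho>' where \<rho>': "\<And>i. i \<in> I \<Longrightarrow> \<rho>' i \<in> Hom K (B i)"
        and q_eq: "\<And>i. i \<in> I \<Longrightarrow> q i = card (orbit (shift G x) (\<rho>' i))"
        by metis
      define \<tau> where "\<tau> a = (\<lambda>i\<in>I. \<rho>' i a)" for a
      define \<rho> where "\<rho> = (\<lambda>a\<in>carrier K. \<psi> (\<tau> a))"
      have hom: "\<tau> \<in> hom K (sum_group I B)"
        unfolding into_sum using \<rho>' by (auto simp: \<tau>_def Hom_def)
      have "(\<lambda>a. \<psi> (\<tau> a)) \<in> hom K A"
        using hom_compose[OF hom \<psi>_hom] by (simp add: o_def)
      then have \<rho>: "\<rho> \<in> Hom K A"
        unfolding \<rho>_def Hom_restrict_iff[OF K] .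
      have "card (orbit (shift G x) \<rho>) = (LCM i\<in>I. card (orbit (shift G x) (\<rho>' i)))"
      proof (rule card_orbit_family[OF G x], fold K_def)
        show "\<rho> \<in> extensional (carrier K)"
          by (simp add: \<rho>_def)
        show "\<rho>' i \<in> extensional (carrier K)" if "i \<in> I" for i
          using \<rho>'[OF that] by (simp add: Hom_def)
        fix a c
        assume ac: "a \<in> carrier K" "c \<in> carrier K"
        then have "\<tau> a \<in> carrier (sum_group I B)" "\<tau> c \<in> carrier (sum_group I B)"
          using hom by (auto simp: hom_def)
        then have "\<psi> (\<tau> a) = \<psi> (\<tau> c) \<longleftrightarrow> \<tau> a = \<tau> c"
          using \<psi>_inj by (auto dest: inj_onD)
        also have "\<dots> \<longleftrightarrow> (\<forall>i\<in>I. \<rho>' i a = \<rho>' i c)"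
          by (auto simp: \<tau>_def restrict_def fun_eq_iff)
        finally show "\<rho> a = \<rho> c \<longleftrightarrow> (\<forall>i\<in>I. \<rho>' i a = \<rho>' i c)"
          using ac by (simp add: \<rho>_def)
      qed
      also have "\<dots> = d"
        using q_eq by (simp add: d)
      finally show "d \<in> orbit_periods G x A"
        unfolding periods using \<rho> by (intro image_eqI[of _ _ \<rho>]) simp_all
    qed
  qed
qed

lemma orbit_periods_nonempty:
  assumes "group G" and "group A"
  shows "orbit_periods G x A \<noteq> {}"
proof -
  let ?K = "commutator_subgroup G"
  have "(\<lambda>a. \<one>\<^bsub>A\<^esub>) \<in> hom ?K A"
    using group.is_monoid[OF \<open>group A\<close>] by (auto simp: hom_def)
  then have "Hom ?K A \<noteq> {}"
    using Hom_restrict_iff[OF group_commutator_subgroup[OF \<open>group G\<close>]] by blast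
  then show ?thesis
    by (simp add: orbit_periods_def shift_orbits_def)
qed

section \<open>Knot groups\<close>

theorem proposition5p4:
  fixes \<K> :: "(real^4) set" and b :: "real^4" and x :: "(real \<Rightarrow> real^4) set"
    and Sigma :: "('s, 't) monoid_scheme"
    and I :: "nat set" and p r :: "nat \<Rightarrow> nat"
  assumes "knot \<K>" and "b \<in> S3 - \<K>" and "meridian \<K> b x"
    and "comm_group Sigma" and "finite (carrier Sigma)"
    and "finite I" and "\<And>i. i \<in> I \<Longrightarrow> prime (p i)" and "\<And>i. i \<in> I \<Longrightarrow> r i \<ge> 1"
    and "Sigma \<cong> sum_group I (\<lambda>i. integer_mod_group (p i ^ r i))"
  shows "(Lcm (orbit_periods (knot_group \<K> b) x Sigma) =
           (LCM i\<in>I. Lcm (orbit_periods (knot_group \<K> b) x (integer_mod_group (p i ^ r i))))) \<and>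
         (orbit_periods (knot_group \<K> b) x Sigma =
           {(LCM i\<in>I. q i) | q :: nat \<Rightarrow> nat.
              \<forall>i\<in>I. q i \<in> orbit_periods (knot_group \<K> b) x (integer_mod_group (p i ^ r i))})"
proof -
  have G: "group (knot_group \<K> b)"
    unfolding knot_group_def by (rule group_fundamental_group) fact
  have x: "x \<in> carrier (knot_group \<K> b)"
    by (rule meridian_in_knot_group) fact
  have Sigma: "group Sigma"
    using \<open>comm_group Sigma\<close> by (simp add: comm_group_def)
  have periods: "orbit_periods (knot_group \<K> b) x Sigma =
      {(LCM i\<in>I. q i) | q. \<forall>i\<in>I. q i \<in> orbit_periods (knot_group \<K> b) x (integer_mod_group (p i ^ r i))}"
    using \<open>finite I\<close> \<open>Sigma \<cong> _\<close> by (intro orbit_periods_sum_group[OF G x Sigma]) auto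
  moreover have "Lcm (orbit_periods (knot_group \<K> b) x Sigma) =
      (LCM i\<in>I. Lcm (orbit_periods (knot_group \<K> b) x (integer_mod_group (p i ^ r i))))"
    unfolding periods by (rule Lcm_of_LCM_choices) (simp add: orbit_periods_nonempty[OF G])
  ultimately show ?thesis
    by (rule conjI[rotated])
qed

end
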